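(* Let $I$ be an instance of the 0--1 Multiple Knapsack Problem (MKP), and let $z_{LPMKP}$ be the optimal value of the linear relaxation of its standard integer programming formulation. Let $I_s$ be any sequential relaxation of $I$, and let $z_{seq}$ be the optimal solution value of $I_s$ (as an instance of the Bounded Sequential Multiple Knapsack Problem). Then $z_{seq}$ is not bigger than $z_{LPMKP}$, i.e. $$z_{LPMKP}\ge z_{seq}.$$
   Context: **MKP and its linear relaxation.** An instance $I$ of MKP consists of $n$ items with weights $w_1,\dots,w_n$ (positive integers) and profits $p_1,\dots,p_n$ (positive real numbers), and $m$ knapsacks with capacities $c_1,\dots,c_m$ (positive integers). The standard formulation is $$\max \sum_{i=1}^{m}\sum_{j=1}^{n} p_jx_{ij}$$ subject to $\sum_{j=1}^{n}w_jx_{ij}\le c_i$ for $i=1,\dots,m$; $\sum_{i=1}^{m}x_{ij}\le 1$ for $j=1,\dots,n$; $x_{ij}\in\{0,1\}$ for all $i,j$. Its linear relaxation is obtained by replacing $x_{ij}\in\{0,1\}$ with $x_{ij}\in[0,1]$ (real) for all $i,j$; $z_{LPMKP}$ denotes the optimal value of this linear relaxation. **BSMKP.** An instance of the Bounded Sequential Multiple Knapsack Problem (BSMKP) consists of items partitioned into $\bar n$ classes and $\bar m$ knapsacks with positive integer capacities $\bar c_1,\dots,\bar c_{\bar m}$. Each item of class $t$ has a positive integer size $s_t$ and a positive real profit $v_t$, and there are $b_t$ items of class $t$ ($b_t$ a positive integer), for $t=1,\dots,\bar n$. The sizes are divisible: $s_{t+1}$ is divisible by $s_t$ for $t=1,\dots,\bar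 n-1$. The optimal solution value is $$\max \sum_{i=1}^{\bar m}\sum_{t=1}^{\bar n}v_ty_{it}$$ subject to $\sum_{t=1}^{\bar n}s_ty_{it}\le \bar c_i$ for $i=1,\dots,\bar m$; $\sum_{i=1}^{\bar m}y_{it}\le b_t$ for $t=1,\dots,\bar n$; $y_{it}$ nonnegative integers. **Sequential relaxation.** A sequential relaxation of an MKP instance $I$ is an instance $I_s$ of BSMKP obtained by replacing each item $j$ of $I$ with a finite set of items $S_j=\{j_1,\dots,j_{K_j}\}$ with positive integer sizes $s_{j_1}\le s_{j_2}\le\dots\le s_{j_{K_j}}$ and profits $v_{j_1},\dots,v_{j_{K_j}}$ such that: 1. $\sum_{k=1}^{K_j}s_{j_k}=w_j$ for $j=1,\dots,n$; 2. $v_{j_k}=\frac{p_j}{w_j}s_{j_k}$ for $j=1,\dots,n$ and $k=1,\dots,K_j$; 3. the sizes $s_{j_k}$, over all $j=1,\dots,n$ and $k=1,\dots,K_j$, are divisible, i.e. when all of them are listed in nondecreasing order, each is divisible by the preceding one. All items of $I_s$ with the same size and the same profit belong to the same class (so $b_t$ is the total number of generated items having the size $s_t$ and profit $v_t$ of class $t$). The knapsacks of $I_s$ are those of $I$: $\bar m=m$ and $\bar c_i=c_i$ for $i=1,\dots,m$. There may be many sequential relaxations of the same instance $I$, depending on the choice of the sizes $s_{j_k}$. *)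

theory Defs
  imports "HOL-Analysis.Analysis"
begin

text \<open>
  Items, knapsacks and classes are indexed from 1. Values of the component functions outside
  the index ranges are irrelevant.
\<close>

record mkp_instance =
  num_items :: nat
  num_knapsacks :: nat
  weight :: "nat \<Rightarrow> nat"
  profit :: "nat \<Rightarrow> real"
  capacity :: "nat \<Rightarrow> nat"

definition mkp :: "mkp_instance \<Rightarrow> bool" where
  "mkp I \<longleftrightarrow>
     (\<forall>j\<in>{1..num_items I}. weight I j > 0 \<and> profit I j > 0) \<and>
     (\<forall>i\<in>{1..num_knapsacks I}. capacity I i > 0)"

text \<open>
  The parameter \<open>D\<close> is the domain of the variables: \<open>D = {0, 1}\<close> gives the integer program,
  \<open>D = {0..1}\<close> its linear relaxation.
\<close>

definition mkp_feasible :: "real set \<Rightarrow> mkp_instance \<Rightarrow> (nat \<Rightarrow> nat \<Rightarrow> real) \<Rightarrow> bool" where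
  "mkp_feasible D I x \<longleftrightarrow>
     (\<forall>i\<in>{1..num_knapsacks I}. (\<Sum>j=1..num_items I. real (weight I j) * x i j) \<le> real (capacity I i)) \<and>
     (\<forall>j\<in>{1..num_items I}. (\<Sum>i=1..num_knapsacks I. x i j) \<le> 1) \<and>
     (\<forall>i\<in>{1..num_knapsacks I}. \<forall>j\<in>{1..num_items I}. x i j \<in> D)"

definition mkp_objective :: "mkp_instance \<Rightarrow> (nat \<Rightarrow> nat \<Rightarrow> real) \<Rightarrow> real" where
  "mkp_objective I x = (\<Sum>i=1..num_knapsacks I. \<Sum>j=1..num_items I. profit I j * x i j)"

text \<open>
  Both optimal values below are suprema in the reals; \<open>z_LPMKP_attained\<close> and \<open>z_BSMKP_attained\<close>
  show that they are maxima.
\<close>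

definition z_LPMKP :: "mkp_instance \<Rightarrow> real" where
  "z_LPMKP I = (SUP x\<in>{x. mkp_feasible {0..1} I x}. mkp_objective I x)"

record bsmkp_instance =
  num_classes :: nat
  num_bins :: nat
  class_size :: "nat \<Rightarrow> nat"
  class_profit :: "nat \<Rightarrow> real"
  class_bound :: "nat \<Rightarrow> nat"
  bin_capacity :: "nat \<Rightarrow> nat"

definition bsmkp :: "bsmkp_instance \<Rightarrow> bool" where
  "bsmkp B \<longleftrightarrow>
     (\<forall>t\<in>{1..num_classes B}. class_size B t > 0 \<and> class_profit B t > 0 \<and> class_bound B t > 0) \<and>
     (\<forall>i\<in>{1..num_bins B}. bin_capacity B i > 0) \<and>
     (\<forall>t\<in>{1..<num_classes B}. class_size B t dvd class_size B (t + 1))"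

definition bsmkp_feasible :: "bsmkp_instance \<Rightarrow> (nat \<Rightarrow> nat \<Rightarrow> nat) \<Rightarrow> bool" where
  "bsmkp_feasible B y \<longleftrightarrow>
     (\<forall>i\<in>{1..num_bins B}. (\<Sum>t=1..num_classes B. class_size B t * y i t) \<le> bin_capacity B i) \<and>
     (\<forall>t\<in>{1..num_classes B}. (\<Sum>i=1..num_bins B. y i t) \<le> class_bound B t)"

definition bsmkp_objective :: "bsmkp_instance \<Rightarrow> (nat \<Rightarrow> nat \<Rightarrow> nat) \<Rightarrow> real" where
  "bsmkp_objective B y = (\<Sum>i=1..num_bins B. \<Sum>t=1..num_classes B. class_profit B t * real (y i t))"

definition z_BSMKP :: "bsmkp_instance \<Rightarrow> real" where
  "z_BSMKP B = (SUP y\<in>{y. bsmkp_feasible B y}. bsmkp_objective B y)"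

text \<open>
  \<open>s j k\<close> and \<open>v j k\<close> are the size and the profit of the \<open>k\<close>-th of the \<open>K j\<close> items that
  replace item \<open>j\<close>.
\<close>

definition item_splitting ::
  "mkp_instance \<Rightarrow> (nat \<Rightarrow> nat) \<Rightarrow> (nat \<Rightarrow> nat \<Rightarrow> nat) \<Rightarrow> (nat \<Rightarrow> nat \<Rightarrow> real) \<Rightarrow> bool" where
  "item_splitting I K s v \<longleftrightarrow>
     (\<forall>j\<in>{1..num_items I}. \<forall>k\<in>{1..K j}. s j k > 0) \<and>
     (\<forall>j\<in>{1..num_items I}. \<forall>k\<in>{1..<K j}. s j k \<le> s j (k + 1)) \<and>
     (\<forall>j\<in>{1..num_items I}. (\<Sum>k=1..K j. s j k) = weight I j) \<and>
     (\<forall>j\<in>{1..num_items I}. \<forall>k\<in>{1..K j}.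
        v j k = profit I j / real (weight I j) * real (s j k)) \<and>
     successively (dvd) (sort [s j k. j \<leftarrow> [1..<num_items I + 1], k \<leftarrow> [1..<K j + 1]])"

text \<open>
  The bijection says that the classes are exactly the distinct pairs (size, profit) of generated
  items, each occurring once. Their order is constrained only through \<open>bsmkp\<close>, so classes with
  equal sizes but different profits may come in any order.
\<close>

definition sequential_relaxation :: "mkp_instance \<Rightarrow> bsmkp_instance \<Rightarrow> bool" where
  "sequential_relaxation I B \<longleftrightarrow> bsmkp B \<and>
     (\<exists>K s v. item_splitting I K s v \<and>
        bij_betw (\<lambda>t. (class_size B t, class_profit B t)) {1..num_classes B}
          ((\<lambda>(j, k). (s j k, v j k)) ` (SIGMA j:{1..num_items I}. {1..K j})) \<and>
        (\<forall>t\<in>{1..num_classes B}.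
           class_bound B t =
             card {(j, k) \<in> (SIGMA j:{1..num_items I}. {1..K j}).
                     s j k = class_size B t \<and> v j k = class_profit B t})) \<and>
     num_bins B = num_knapsacks I \<and>
     (\<forall>i\<in>{1..num_knapsacks I}. bin_capacity B i = capacity I i)"

lemma z_LPMKP_attained:
  "\<exists>x. mkp_feasible {0..1} I x \<and> mkp_objective I x = z_LPMKP I \<and>
       (\<forall>x'. mkp_feasible {0..1} I x' \<longrightarrow> mkp_objective I x' \<le> z_LPMKP I)"
proof -
  let ?m = "num_knapsacks I" and ?n = "num_items I"
  define C :: "(nat \<Rightarrow> nat \<Rightarrow> real) set" where
    "C = PiE UNIV (\<lambda>i. PiE UNIV (\<lambda>j. {0..1}))"
  have "compactin euclidean (PiE UNIV (\<lambda>j::nat. {0..1::real}))"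
    by (subst euclidean_product_topology [symmetric], subst compactin_PiE) auto
  then have "compactin euclidean C"
    unfolding C_def by (subst euclidean_product_topology [symmetric], subst compactin_PiE) auto
  then have "compact C"
    by simp
  have coord [continuous_intros]: "continuous_on UNIV (\<lambda>x::nat \<Rightarrow> nat \<Rightarrow> real. x i j)" for i j
    by (rule continuous_on_product_then_coordinatewise)
       (rule continuous_on_product_coordinates)
  have obj: "continuous_on UNIV (mkp_objective I)"
    unfolding mkp_objective_def by (intro continuous_intros)
  have "closed {x. mkp_feasible {0..1} I x}"
    unfolding mkp_feasible_def Ball_def atLeastAtMost_iff[of _ "0::real" 1]
    by (intro closed_Collect_conj closed_Collect_all closed_Collect_imp closed_Collect_le
          open_Collect_const continuous_intros)
  then have comp: "compact (C \<inter> {x. mkp_feasible {0..1} I x})"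
    using \<open>compact C\<close> by blast
  have "(\<lambda>i j. 0) \<in> C \<inter> {x. mkp_feasible {0..1} I x}"
    by (auto simp: C_def mkp_feasible_def)
  then obtain x where x: "x \<in> C \<inter> {x. mkp_feasible {0..1} I x}"
    and max: "\<forall>x'\<in>C \<inter> {x. mkp_feasible {0..1} I x}. mkp_objective I x' \<le> mkp_objective I x"
    using continuous_attains_sup[OF comp _ continuous_on_subset[OF obj]] by blast
  have le: "mkp_objective I x' \<le> mkp_objective I x" if x': "mkp_feasible {0..1} I x'" for x'
  proof -
    define x'' where "x'' = (\<lambda>i j. if i \<in> {1..?m} \<and> j \<in> {1..?n} then x' i j else 0)"
    have "mkp_feasible {0..1} I x''" "mkp_objective I x'' = mkp_objective I x'"
      using x' by (simp_all add: mkp_feasible_def mkp_objective_def x''_def)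
    moreover have "x'' \<in> C"
      using x' by (auto simp: C_def x''_def mkp_feasible_def)
    ultimately show ?thesis
      using max by (metis IntI mem_Collect_eq)
  qed
  have "z_LPMKP I = mkp_objective I x"
    unfolding z_LPMKP_def by (rule cSup_eq_maximum) (use x le in auto)
  then show ?thesis
    using x le by auto
qed

lemma z_BSMKP_attained:
  "\<exists>y. bsmkp_feasible B y \<and> bsmkp_objective B y = z_BSMKP B \<and>
       (\<forall>y'. bsmkp_feasible B y' \<longrightarrow> bsmkp_objective B y' \<le> z_BSMKP B)"
proof -
  let ?m = "num_bins B" and ?n = "num_classes B"
  let ?R = "{1..?m} \<times> {1..?n}"
  define F where "F = PiE ?R (\<lambda>(i, t). {0..class_bound B t})"
  let ?V = "bsmkp_objective B ` {y. bsmkp_feasible B y}"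
  have "finite F"
    unfolding F_def by (intro finite_PiE) auto
  moreover have "?V \<subseteq> (\<lambda>f. bsmkp_objective B (\<lambda>i t. f (i, t))) ` F"
  proof (rule image_subsetI)
    fix y assume "y \<in> {y. bsmkp_feasible B y}"
    then have y: "bsmkp_feasible B y" by simp
    have bound: "y i t \<le> class_bound B t" if "i \<in> {1..?m}" "t \<in> {1..?n}" for i t
    proof -
      have "y i t \<le> (\<Sum>i=1..?m. y i t)"
        using that by (intro member_le_sum) auto
      also have "\<dots> \<le> class_bound B t"
        using y that by (simp add: bsmkp_feasible_def)
      finally show ?thesis .
    qed
    let ?f = "restrict (\<lambda>(i, t). y i t) ?R"
    have "bsmkp_objective B y = bsmkp_objective B (\<lambda>i t. ?f (i, t))"
      by (simp add: bsmkp_objective_def)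
    moreover have "?f \<in> F"
      using bound by (auto simp: F_def)
    ultimately show "bsmkp_objective B y \<in> (\<lambda>f. bsmkp_objective B (\<lambda>i t. f (i, t))) ` F"
      by blast
  qed
  ultimately have fin: "finite ?V"
    using finite_subset by blast
  have "bsmkp_feasible B (\<lambda>i t. 0)"
    by (simp add: bsmkp_feasible_def)
  then have ne: "?V \<noteq> {}" by blast
  have "z_BSMKP B = Max ?V"
    unfolding z_BSMKP_def using fin ne by (rule cSup_eq_Max)
  then show ?thesis
    using Max_in[OF fin ne] Max_ge[OF fin] by force
qed

end

theory Submission
  imports Defs
begin

text \<open>
  A solution \<open>y\<close> of the sequential relaxation is spread evenly over the generated items: each of
  the \<open>b\<^sub>t\<close> items of class \<open>t\<close> goes to knapsack \<open>i\<close> with fraction \<open>y\<^sub>i\<^sub>t / b\<^sub>t\<close>. Regrouping the generated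
  items by their origin \<open>j\<close> gives a fractional solution of the MKP instance. It uses the same
  capacity and has the same profit as \<open>y\<close>, because splitting an item preserves its total size and
  its profit density.
\<close>

text \<open>Group \<open>P\<close> by the value of \<open>c\<close>: the summand is constant on the
  fibre over \<open>t\<close>, which has exactly \<open>b t\<close> elements, so the positive
  divisor \<open>b t\<close> cancels. Below, \<open>c\<close> sends generated items to their
  classes.\<close>

lemma sum_fibres:
  fixes f g :: "'b \<Rightarrow> real"
  assumes "finite P" "finite T" "c ` P \<subseteq> T"
    and b: "\<And>t. t \<in> T \<Longrightarrow> b t = card {q \<in> P. c q = t}" "\<And>t. t \<in> T \<Longrightarrow> b t > 0"
  shows "(\<Sum>q\<in>P. f (c q) * (g (c q) / real (b (c q)))) = (\<Sum>t\<in>T. f t * g t)"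
proof -
  have "(\<Sum>q\<in>P. f (c q) * (g (c q) / real (b (c q)))) =
      (\<Sum>t\<in>T. \<Sum>q\<in>{q \<in> P. c q = t}. f (c q) * (g (c q) / real (b (c q))))"
    using assms(1-3) by (rule sum.group [symmetric])
  also have "\<dots> = (\<Sum>t\<in>T. real (card {q \<in> P. c q = t}) * (f t * (g t / real (b t))))"
    by simp
  also have "\<dots> = (\<Sum>t\<in>T. f t * g t)"
    by (intro sum.cong refl) (use b in \<open>simp flip: b(1)\<close>)
  finally show ?thesis .
qed

text \<open>Distinct classes have distinct pairs (size, profit), so inverting the bijection assigns
  a class \<open>c (j, k)\<close> to each generated item. This turns the class bounds into fibre
  cardinalities, as \<open>sum_fibres\<close> needs.\<close>

lemma sequential_relaxation_class_map:
  assumes "sequential_relaxation I B"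
  obtains K s v c where "item_splitting I K s v"
    "\<And>j k. j \<in> {1..num_items I} \<Longrightarrow> k \<in> {1..K j} \<Longrightarrow> c (j, k) \<in> {1..num_classes B} \<and>
       class_size B (c (j, k)) = s j k \<and> class_profit B (c (j, k)) = v j k"
    "\<And>t. t \<in> {1..num_classes B} \<Longrightarrow>
       class_bound B t = card {q \<in> (SIGMA j:{1..num_items I}. {1..K j}). c q = t}"
proof -
  obtain K s v where split: "item_splitting I K s v"
    and bij: "bij_betw (\<lambda>t. (class_size B t, class_profit B t)) {1..num_classes B}
          ((\<lambda>(j, k). (s j k, v j k)) ` (SIGMA j:{1..num_items I}. {1..K j}))"
    and card: "\<forall>t\<in>{1..num_classes B}. class_bound B t =
             card {(j, k) \<in> (SIGMA j:{1..num_items I}. {1..K j}).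
                     s j k = class_size B t \<and> v j k = class_profit B t}"
    using assms unfolding sequential_relaxation_def by blast
  let ?T = "{1..num_classes B}" and ?P = "SIGMA j:{1..num_items I}. {1..K j}"
  let ?C = "\<lambda>t. (class_size B t, class_profit B t)"
  define c where "c = (\<lambda>(j, k). inv_into ?T ?C (s j k, v j k))"
  have c: "c (j, k) \<in> ?T \<and> class_size B (c (j, k)) = s j k \<and> class_profit B (c (j, k)) = v j k"
    if "j \<in> {1..num_items I}" "k \<in> {1..K j}" for j k
  proof -
    have "(s j k, v j k) \<in> ?C ` ?T"
      using that unfolding bij_betw_imp_surj_on[OF bij] by force
    then show ?thesis
      using inv_into_into[of "(s j k, v j k)" ?C ?T] f_inv_into_f[of "(s j k, v j k)" ?C ?T]
      by (simp add: c_def)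
  qed
  have inj: "inj_on ?C ?T"
    using bij by (rule bij_betw_imp_inj_on)
  have "{(j, k) \<in> ?P. s j k = class_size B t \<and> v j k = class_profit B t} = {q \<in> ?P. c q = t}"
    if t: "t \<in> ?T" for t
  proof -
    have "s j k = class_size B t \<and> v j k = class_profit B t \<longleftrightarrow> c (j, k) = t"
      if "j \<in> {1..num_items I}" "k \<in> {1..K j}" for j k
      using c[OF that] inj_onD[OF inj, of "c (j, k)" t] t by auto
    then show ?thesis by blast
  qed
  then show thesis
    using that[OF split c] card by simp
qed

lemma sequential_solution_spread:
  assumes I: "mkp I" and rel: "sequential_relaxation I B" and y: "bsmkp_feasible B y"
  obtains x where "mkp_feasible {0..1} I x" "mkp_objective I x = bsmkp_objective B y"
proof -
  let ?n = "num_items I" and ?m = "num_knapsacks I" and ?T = "{1..num_classes B}"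
  obtain K s v c where split: "item_splitting I K s v"
    and c: "\<And>j k. j \<in> {1..?n} \<Longrightarrow> k \<in> {1..K j} \<Longrightarrow> c (j, k) \<in> ?T \<and>
       class_size B (c (j, k)) = s j k \<and> class_profit B (c (j, k)) = v j k"
    and card: "\<And>t. t \<in> ?T \<Longrightarrow>
       class_bound B t = card {q \<in> (SIGMA j:{1..?n}. {1..K j}). c q = t}"
    by (rule sequential_relaxation_class_map[OF rel], rule that) blast+
  have bins: "num_bins B = ?m" "\<And>i. i \<in> {1..?m} \<Longrightarrow> bin_capacity B i = capacity I i"
    and pos: "\<And>t. t \<in> ?T \<Longrightarrow> class_bound B t > 0"
    using rel by (auto simp: sequential_relaxation_def bsmkp_def)
  have w: "weight I j > 0" if "j \<in> {1..?n}" for j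
    using I that by (auto simp: mkp_def)
  define r where "r i j k = real (y i (c (j, k))) / real (class_bound B (c (j, k)))" for i j k
  \<comment> \<open>The mean of the fractions \<open>r i j k\<close> over the pieces of item
    \<open>j\<close>, weighted by size: the sizes \<open>s j k\<close> add up to
    \<open>weight I j\<close>.\<close>
  define x where "x i j = (\<Sum>k=1..K j. real (s j k) * r i j k) / real (weight I j)" for i j
  \<comment> \<open>\<open>f\<close> stays arbitrary so that one regrouping serves both capacity
    (sizes) and objective (profits).\<close>
  have spread: "(\<Sum>j=1..?n. \<Sum>k=1..K j. f (c (j, k)) * r i j k) = (\<Sum>t\<in>?T. f t * real (y i t))"
    for f :: "nat \<Rightarrow> real" and i
  proof -
    have "(\<Sum>j=1..?n. \<Sum>k=1..K j. f (c (j, k)) * r i j k) =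
        (\<Sum>q\<in>(SIGMA j:{1..?n}. {1..K j}).
          f (c q) * (real (y i (c q)) / real (class_bound B (c q))))"
      by (simp add: sum.Sigma r_def)
    also have "\<dots> = (\<Sum>t\<in>?T. f t * real (y i t))"
      by (rule sum_fibres) (use c card pos in auto)
    finally show ?thesis .
  qed
  have used: "(\<Sum>j=1..?n. real (weight I j) * x i j) = (\<Sum>t\<in>?T. real (class_size B t) * real (y i t))"
    for i
  proof -
    have "(\<Sum>j=1..?n. real (weight I j) * x i j) =
        (\<Sum>j=1..?n. \<Sum>k=1..K j. real (class_size B (c (j, k))) * r i j k)"
      using w c by (intro sum.cong refl) (simp add: x_def)
    then show ?thesis
      using spread[of "\<lambda>t. real (class_size B t)" i] by simp
  qed
  have gain: "(\<Sum>j=1..?n. profit I j * x i j) = (\<Sum>t\<in>?T. class_profit B t * real (y i t))" for i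
  proof -
    have "profit I j * x i j = (\<Sum>k=1..K j. class_profit B (c (j, k)) * r i j k)"
      if j: "j \<in> {1..?n}" for j
    proof -
      \<comment> \<open>Equal profit density: the factor \<open>profit I j / weight I j\<close> that
        arises from \<open>x i j\<close> turns each \<open>s j k\<close> into
        \<open>v j k\<close>.\<close>
      have "v j k = profit I j / real (weight I j) * real (s j k)" if "k \<in> {1..K j}" for k
        using split j that unfolding item_splitting_def by blast
      then show ?thesis
        using c[OF j] by (simp add: x_def sum_divide_distrib sum_distrib_left mult.assoc)
    qed
    then show ?thesis
      using spread[of "class_profit B" i] by simp
  qed
  have once: "(\<Sum>i=1..?m. x i j) \<le> 1" if j: "j \<in> {1..?n}" for j
  proof -
    \<comment> \<open>The class bound limits the total fraction of each single piece to 1; averaging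
      over the pieces of \<open>j\<close> then keeps the bound.\<close>
    have le: "(\<Sum>i=1..?m. r i j k) \<le> 1" if k: "k \<in> {1..K j}" for k
    proof -
      let ?t = "c (j, k)"
      have t: "?t \<in> ?T" using c[OF j k] by simp
      then have "(\<Sum>i=1..?m. y i ?t) \<le> class_bound B ?t"
        using y bins(1) by (simp add: bsmkp_feasible_def)
      then have "(\<Sum>i=1..?m. real (y i ?t)) \<le> real (class_bound B ?t)"
        by (metis of_nat_le_iff of_nat_sum)
      then show ?thesis
        using pos[OF t] by (simp add: r_def flip: sum_divide_distrib)
    qed
    have "(\<Sum>i=1..?m. \<Sum>k=1..K j. real (s j k) * r i j k) =
        (\<Sum>k=1..K j. real (s j k) * (\<Sum>i=1..?m. r i j k))"
      by (subst sum.swap) (simp add: sum_distrib_left)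
    also have "\<dots> \<le> (\<Sum>k=1..K j. real (s j k))"
      by (intro sum_mono mult_left_le le) auto
    also have "\<dots> = real (\<Sum>k=1..K j. s j k)"
      by simp
    also have "\<dots> = real (weight I j)"
      using split j unfolding item_splitting_def by metis
    finally show ?thesis
      using w[OF j] by (simp add: x_def flip: sum_divide_distrib)
  qed
  have nonneg: "x i j \<ge> 0" for i j
    unfolding x_def r_def by (intro divide_nonneg_nonneg sum_nonneg mult_nonneg_nonneg) auto
  \<comment> \<open>One term of a nonnegative sum that is at most 1.\<close>
  have "x i j \<le> 1" if "i \<in> {1..?m}" "j \<in> {1..?n}" for i j
    using member_le_sum[of i "{1..?m}" "\<lambda>i. x i j"] once[OF that(2)] that(1) nonneg by simp
  moreover have "(\<Sum>j=1..?n. real (weight I j) * x i j) \<le> real (capacity I i)"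
    if i: "i \<in> {1..?m}" for i
  proof -
    have "(\<Sum>t\<in>?T. class_size B t * y i t) \<le> capacity I i"
      using y i bins by (simp add: bsmkp_feasible_def)
    then have "real (\<Sum>t\<in>?T. class_size B t * y i t) \<le> real (capacity I i)"
      by (rule of_nat_mono)
    then show ?thesis
      using used[of i] by simp
  qed
  ultimately have "mkp_feasible {0..1} I x"
    using once nonneg by (auto simp: mkp_feasible_def)
  moreover have "mkp_objective I x = bsmkp_objective B y"
    using gain bins(1) by (simp add: mkp_objective_def bsmkp_objective_def)
  ultimately show thesis
    by (rule that)
qed

theorem lemma3:
  fixes I :: mkp_instance and I\<^sub>s :: bsmkp_instance
  assumes "mkp I"
    and "sequential_relaxation I I\<^sub>s"
  shows "z_LPMKP I \<ge> z_BSMKP I\<^sub>s"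
  \<comment> \<open>Since \<open>z_BSMKP\<close> is attained, spreading one optimal solution
    suffices.\<close>
  using z_BSMKP_attained[of I\<^sub>s] z_LPMKP_attained[of I] sequential_solution_spread[OF assms]
  by metis

end
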